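(* Let $0<b_1<b_2<1$, $\kappa=\frac{1-b_1}{1-b_2}$, and let $H$ be the height function of the stochastic six-vertex model on the quadrant with parameters $b_1,b_2$ and step initial conditions. Let $g(\mu)=\frac{(\sqrt{\mu}-\sqrt{\kappa})^2}{\kappa-1}$ for $\mu\in[\kappa^{-1},\kappa]$. For every $\varepsilon>0$ there exists a constant $c=c(\varepsilon)>0$ such that for any $\mu\in[\kappa^{-1}+\varepsilon,\kappa-\varepsilon]$, any integer $T\ge1$ and any $s\ge0$, $$\mathbb{P}\left[H(T\mu,T)\le g(\mu)T-sT^{1/3}\right]\le c^{-1}e^{-cs},$$ and $c$ can be chosen to weakly decrease as $\varepsilon$ decreases.
   Context: Stochastic six-vertex model on the quadrant with step initial conditions: each vertex $(x,t)\in\mathbb{Z}_{\ge0}\times\mathbb{Z}_{\ge0}$ has two incoming edges (bottom, left) and two outgoing edges (top, right), each occupied or empty. All edges entering $(0,t)$ from the left, $t\ge0$, are occupied; all edges entering $(x,0)$ from below, $x\ge0$, are empty. Vertices are sampled successively (e.g. by increasing $x+t$), independently given the incoming edges: if both incoming edges are occupied both outgoing edges are occupied; if both are empty both outgoing are empty; if only the bottom edge is occupied, the top edge only is occupied with probability $b_1$ and the right edge only with probability $1-b_1$; if only the left edge is occupied, the right edge only is occupied with probability $b_2$ and the top edge only with probability $1-b_2$. Let $\eta_t(x)\in\{0,1\}$ indicate whether the edge entering $(x,t)$ from below is occupied. The height function is $H(x,t)=t-\sum_{0\le y<x}\eta_t(y)$ for integers $x,t\ge0$ (equivalently $H(x,0)=0$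 and $H$ increases by $1$ when crossing a path in the upward vertical direction). For non-integer arguments, integer parts are taken. *)

theory Defs
  imports "HOL-Probability.Probability"
begin

text \<open>Edge configurations at a vertex are pairs of Booleans (True = occupied):
  incoming edges are listed as (bottom, left), outgoing edges as (top, right).\<close>

definition s6v_vertex_law :: "real \<Rightarrow> real \<Rightarrow> bool \<times> bool \<Rightarrow> (bool \<times> bool) pmf" where
  "s6v_vertex_law b1 b2 i =
     (case i of
        (True, True) \<Rightarrow> return_pmf (True, True)
      | (False, False) \<Rightarrow> return_pmf (False, False)
      | (True, False) \<Rightarrow> map_pmf (\<lambda>u. if u then (True, False) else (False, True)) (bernoulli_pmf b1)
      | (False, True) \<Rightarrow> map_pmf (\<lambda>u. if u then (False, True) else (True, False)) (bernoulli_pmf b2))"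

text \<open>The randomness of the model: for every vertex \<open>(x, t)\<close> and every possible incoming
  configuration \<open>i\<close>, an independent outcome \<open>\<omega> ((x, t), i)\<close> with the law above.  The
  vertex \<open>(x, t)\<close> uses only the outcome belonging to its actual incoming configuration, which
  is a function of the outcomes at other vertices.  Hence, given the incoming edges (and
  everything sampled before), the outgoing edges at \<open>(x, t)\<close> follow the vertex law.\<close>

type_synonym s6v_env = "(nat \<times> nat) \<times> (bool \<times> bool) \<Rightarrow> bool \<times> bool"

definition s6v_measure :: "real \<Rightarrow> real \<Rightarrow> s6v_env measure" where
  "s6v_measure b1 b2 = PiM UNIV (\<lambda>(_, i). measure_pmf (s6v_vertex_law b1 b2 i))"

text \<open>Occupation of the edge entering \<open>(x, t)\<close> from below (this is \<open>\<eta>\<^sub>t(x)\<close>) and of the edge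
  entering \<open>(x, t)\<close> from the left, with step initial conditions.\<close>

fun s6v_bottom :: "s6v_env \<Rightarrow> nat \<Rightarrow> nat \<Rightarrow> bool"
  and s6v_left :: "s6v_env \<Rightarrow> nat \<Rightarrow> nat \<Rightarrow> bool" where
  "s6v_bottom \<omega> x 0 = False"
| "s6v_bottom \<omega> x (Suc t) = fst (\<omega> ((x, t), (s6v_bottom \<omega> x t, s6v_left \<omega> x t)))"
| "s6v_left \<omega> 0 t = True"
| "s6v_left \<omega> (Suc x) t = snd (\<omega> ((x, t), (s6v_bottom \<omega> x t, s6v_left \<omega> x t)))"

definition s6v_height_nat :: "s6v_env \<Rightarrow> nat \<Rightarrow> nat \<Rightarrow> int" where
  "s6v_height_nat \<omega> x t = int t - (\<Sum>y<x. of_bool (s6v_bottom \<omega> y t))"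

definition s6v_height :: "s6v_env \<Rightarrow> real \<Rightarrow> real \<Rightarrow> int" where
  "s6v_height \<omega> x t = s6v_height_nat \<omega> (nat \<lfloor>x\<rfloor>) (nat \<lfloor>t\<rfloor>)"

definition s6v_kappa :: "real \<Rightarrow> real \<Rightarrow> real" where
  "s6v_kappa b1 b2 = (1 - b1) / (1 - b2)"

definition s6v_limit_shape :: "real \<Rightarrow> real \<Rightarrow> real" where
  "s6v_limit_shape \<kappa> \<mu> = (sqrt \<mu> - sqrt \<kappa>)\<^sup>2 / (\<kappa> - 1)"

lemma prob_space_s6v_measure: "prob_space (s6v_measure b1 b2)"
  unfolding s6v_measure_def
  by (rule prob_space_PiM) (auto intro: prob_space_measure_pmf split: prod.splits)

lemma measurable_s6v_outcome:
  assumes "Measurable.pred (s6v_measure b1 b2) f" "Measurable.pred (s6v_measure b1 b2) g"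
  shows "(\<lambda>\<omega>. \<omega> (p, (f \<omega>, g \<omega>))) \<in> s6v_measure b1 b2 \<rightarrow>\<^sub>M count_space UNIV"
proof -
  have *: "(\<lambda>\<omega>. \<omega> (p, i)) \<in> s6v_measure b1 b2 \<rightarrow>\<^sub>M count_space UNIV" for i
  proof -
    have "(\<lambda>\<omega>. \<omega> (p, i)) \<in> s6v_measure b1 b2 \<rightarrow>\<^sub>M measure_pmf (s6v_vertex_law b1 b2 i)"
      unfolding s6v_measure_def
      using measurable_component_singleton[of "(p, i)" UNIV
          "\<lambda>(_, i). measure_pmf (s6v_vertex_law b1 b2 i)"] by simp
    then show ?thesis by (simp add: measurable_def)
  qed
  have "(\<lambda>\<omega>. (f \<omega>, g \<omega>)) \<in> s6v_measure b1 b2 \<rightarrow>\<^sub>M count_space UNIV"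
    using assms measurable_Pair[OF assms] by (simp add: pair_measure_countable)
  then show ?thesis
    using measurable_compose_countable[of "\<lambda>i \<omega>. \<omega> (p, i)" "s6v_measure b1 b2", OF *] by blast
qed

lemma measurable_s6v_edges:
  "Measurable.pred (s6v_measure b1 b2) (\<lambda>\<omega>. s6v_bottom \<omega> x t)"
  "Measurable.pred (s6v_measure b1 b2) (\<lambda>\<omega>. s6v_left \<omega> x t)"
proof (induction x t and x t rule: s6v_bottom_s6v_left.induct)
qed (auto intro!: measurable_compose[OF measurable_s6v_outcome])

lemma measurable_s6v_height:
  "(\<lambda>\<omega>. s6v_height \<omega> x t) \<in> s6v_measure b1 b2 \<rightarrow>\<^sub>M count_space UNIV"
proof -
  note [measurable] = measurable_s6v_edges
  have "(\<lambda>\<omega>. \<Sum>y<n. of_bool (s6v_bottom \<omega> y m) :: int) \<in> s6v_measure b1 b2 \<rightarrow>\<^sub>M count_space UNIV"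
    for n m
    by (induction n) simp_all
  then show ?thesis unfolding s6v_height_def s6v_height_nat_def by simp
qed

end

theory Submission
  imports Defs
begin

text \<open>Compare the step model with a model whose boundary edges are independent Bernoulli variables,
  of density \<open>p\<close> at the bottom and \<open>q\<close> on the left, driven by the same environment. The
  model is attractive in the edge occupations, so the height can only drop when particles are
  added at the bottom, and only drop when particles are then removed on the left. Hence \<open>H \<ge> R - B\<close>,
  where \<open>B\<close> counts the particles entering from below in the comparison model and \<open>R\<close> those
  leaving on the right. If \<open>q (1 - p) = \<kappa> p (1 - q)\<close> the comparison model is stationary and both
  \<open>B\<close> and \<open>R\<close> are binomial; averaging \<open>exp (- l H) exp (- l B) \<le> exp (- l R)\<close> gives
  \<open>E (exp (- l H)) \<le> (1 - q + q exp (- l)) ^ T / (1 - p + p exp (- l)) ^ x\<close>,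
  because \<open>H\<close> and \<open>B\<close> are independent. For \<open>x = \<mu> T\<close> the density \<open>p\<close> that
  maximises the drift \<open>q - \<mu> p\<close> yields \<open>g \<mu>\<close> as maximum and kills the quadratic term in \<open>l\<close>,
  since \<open>dq/dp = q (1 - q) / (p (1 - p))\<close>. Taking \<open>l = T powr (- 1/3)\<close> leaves a bounded cubic
  error, uniformly in \<open>\<mu>\<close>, so that \<open>c\<close> can even be chosen constant.\<close>

section \<open>Evolution of edge states along lattice paths\<close>

text \<open>A state records the occupation of the edges along a down-right lattice path: \<open>Inl x\<close> is the
  vertical edge of the path in column \<open>x\<close> and \<open>Inr t\<close> its horizontal edge in row \<open>t\<close>. Pushing
  the path across a vertex replaces the two incoming edges by the two outgoing ones.\<close>

type_synonym s6v_state = "nat + nat \<Rightarrow> bool"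

definition set_vertex :: "nat \<times> nat \<Rightarrow> bool \<times> bool \<Rightarrow> s6v_state \<Rightarrow> s6v_state" where
  "set_vertex v out \<sigma> = \<sigma>(Inl (fst v) := fst out, Inr (snd v) := snd out)"

definition get_vertex :: "nat \<times> nat \<Rightarrow> s6v_state \<Rightarrow> bool \<times> bool" where
  "get_vertex v \<sigma> = (\<sigma> (Inl (fst v)), \<sigma> (Inr (snd v)))"

definition visit :: "s6v_env \<Rightarrow> nat \<times> nat \<Rightarrow> s6v_state \<Rightarrow> s6v_state" where
  "visit \<omega> v \<sigma> = set_vertex v (\<omega> (v, get_vertex v \<sigma>)) \<sigma>"

text \<open>The only property of the environment that the pathwise comparison uses; it holds almost
  surely by \<open>AE_conservative\<close>.\<close>

definition conservative :: "s6v_env \<Rightarrow> bool" where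
  "conservative \<omega> \<longleftrightarrow> (\<forall>v i. of_bool (fst (\<omega> (v, i))) + of_bool (snd (\<omega> (v, i)))
     = (of_bool (fst i) + of_bool (snd i) :: int))"

definition step_state :: s6v_state where
  "step_state = case_sum (\<lambda>_. False) (\<lambda>_. True)"

lemma product_Suc: "List.product [0..<Suc x] ys = List.product [0..<x] ys @ map (Pair x) ys"
proof -
  have "List.product (xs @ [x]) ys = List.product xs ys @ map (Pair x) ys" for xs
    by (induction xs) auto
  then show ?thesis by simp
qed

text \<open>While column \<open>x\<close> is swept upwards, \<open>Inl x\<close> carries its current
  vertical edge, and each visited \<open>Inr i\<close> passes from the left edge of column
  \<open>x\<close> to that of column \<open>Suc x\<close>.\<close>

lemma fold_visit_column:
  assumes "j \<le> t" "\<forall>y\<ge>x. \<sigma> (Inl y) = s6v_bottom \<omega> y 0" "\<forall>i<t. \<sigma> (Inr i) = s6v_left \<omega> x i"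
  shows "fold (visit \<omega>) (map (Pair x) [0..<j]) \<sigma> =
    case_sum (\<lambda>y. if y = x then s6v_bottom \<omega> x j else \<sigma> (Inl y))
      (\<lambda>i. if i < j then s6v_left \<omega> (Suc x) i else \<sigma> (Inr i))"
  using assms
proof (induction j)
  case 0
  then show ?case by (auto simp: fun_eq_iff split: sum.splits)
next
  case (Suc j)
  then show ?case
    by (auto simp: fun_eq_iff visit_def set_vertex_def get_vertex_def less_Suc_eq split: sum.splits)
qed

text \<open>Identifies the sweep with the recursively defined edges. Unvisited columns read False
  because the bottom boundary is empty, unvisited rows True because the left one is full.\<close>

lemma fold_visit_step:
  "fold (visit \<omega>) (List.product [0..<x] [0..<t]) step_state =
    case_sum (\<lambda>y. y < x \<and> s6v_bottom \<omega> y t) (\<lambda>i. if i < t then s6v_left \<omega> x i else True)"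
proof (induction x)
  case 0
  then show ?case by (auto simp: fun_eq_iff step_state_def split: sum.splits)
next
  case (Suc x)
  show ?case
    unfolding product_Suc fold_append comp_def Suc.IH
    by (subst fold_visit_column[where t = t]) (auto simp: fun_eq_iff less_Suc_eq split: sum.splits)
qed

section \<open>Attractiveness and particle conservation\<close>

text \<open>Equal inputs share one outcome. If two distinct inputs are comparable, the smaller is
  empty or the larger is full, and conservation forces the output there to be empty or full as
  well.\<close>

lemma visit_mono:
  assumes "conservative \<omega>" "\<sigma> \<le> \<sigma>'"
  shows "visit \<omega> v \<sigma> \<le> visit \<omega> v \<sigma>'"
proof -
  have le: "fst (get_vertex v \<sigma>) \<le> fst (get_vertex v \<sigma>')" "snd (get_vertex v \<sigma>) \<le> snd (get_vertex v \<sigma>')"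
    using assms(2) by (auto simp: get_vertex_def le_fun_def)
  have c: "of_bool (fst (\<omega> (v, i))) + of_bool (snd (\<omega> (v, i)))
     = (of_bool (fst i) + of_bool (snd i) :: int)" for i
    using assms(1) unfolding conservative_def by blast
  have "fst (\<omega> (v, i)) \<le> fst (\<omega> (v, i')) \<and> snd (\<omega> (v, i)) \<le> snd (\<omega> (v, i'))"
    if "fst i \<le> fst i'" "snd i \<le> snd i'" for i i'
  proof (cases "i = i'")
    case False
    with that have "i = (False, False) \<or> i' = (True, True)"
      by (cases i; cases i') auto
    with c[of i] c[of i'] show ?thesis
      by (auto simp: of_bool_def split: if_splits)
  qed simp
  from this[OF le] assms(2) show ?thesis
    by (auto simp: visit_def set_vertex_def le_fun_def)
qed

lemma fold_visit_mono:
  assumes "conservative \<omega>" "\<sigma> \<le> \<sigma>'"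
  shows "fold (visit \<omega>) vs \<sigma> \<le> fold (visit \<omega>) vs \<sigma>'"
  using assms(2)
proof (induction vs arbitrary: \<sigma> \<sigma>')
  case (Cons v vs)
  show ?case using Cons.IH[OF visit_mono[OF assms(1) Cons.prems]] by simp
qed simp

text \<open>A visit changes one \<open>Inl\<close> entry and one \<open>Inr\<close> entry and
  preserves their sum; both lie in the rectangle and so are counted.\<close>

lemma fold_visit_conserved:
  assumes "conservative \<omega>" "set vs \<subseteq> {..<x} \<times> {..<t}"
  shows "(\<Sum>y<x. of_bool (fold (visit \<omega>) vs \<sigma> (Inl y))) + (\<Sum>j<t. of_bool (fold (visit \<omega>) vs \<sigma> (Inr j)))
       = (\<Sum>y<x. of_bool (\<sigma> (Inl y))) + (\<Sum>j<t. of_bool (\<sigma> (Inr j)) :: int)"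
  using assms(2)
proof (induction vs arbitrary: \<sigma>)
  case (Cons v vs)
  obtain y j where v: "v = (y, j)" "y < x" "j < t"
    using Cons.prems by (cases v) auto
  have "of_bool (fst (\<omega> (v, get_vertex v \<sigma>))) + of_bool (snd (\<omega> (v, get_vertex v \<sigma>)))
     = (of_bool (\<sigma> (Inl y)) + of_bool (\<sigma> (Inr j)) :: int)"
    using assms(1) by (simp add: conservative_def get_vertex_def v)
  moreover have "(\<Sum>y'<x. of_bool (\<tau> (Inl y'))) = of_bool (\<tau> (Inl y)) + (\<Sum>y'\<in>{..<x} - {y}. of_bool (\<tau> (Inl y')) :: int)"
    "(\<Sum>i<t. of_bool (\<tau> (Inr i))) = of_bool (\<tau> (Inr j)) + (\<Sum>i\<in>{..<t} - {j}. of_bool (\<tau> (Inr i)) :: int)"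
    for \<tau> :: s6v_state
    using v sum.remove[of "{..<x}" y "\<lambda>y. of_bool (\<tau> (Inl y)) :: int"]
      sum.remove[of "{..<t}" j "\<lambda>j. of_bool (\<tau> (Inr j)) :: int"] by (simp_all del: sum_of_bool_eq)
  moreover have "(\<Sum>y'\<in>{..<x} - {y}. of_bool (visit \<omega> v \<sigma> (Inl y'))) = (\<Sum>y'\<in>{..<x} - {y}. of_bool (\<sigma> (Inl y')) :: int)"
    "(\<Sum>i\<in>{..<t} - {j}. of_bool (visit \<omega> v \<sigma> (Inr i))) = (\<Sum>i\<in>{..<t} - {j}. of_bool (\<sigma> (Inr i)) :: int)"
    using v by (auto intro!: sum.cong simp: visit_def set_vertex_def simp del: sum_of_bool_eq)
  moreover have "visit \<omega> v \<sigma> (Inl y) = fst (\<omega> (v, get_vertex v \<sigma>))" "visit \<omega> v \<sigma> (Inr j) = snd (\<omega> (v, get_vertex v \<sigma>))"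
    by (simp_all add: visit_def set_vertex_def v)
  ultimately have "(\<Sum>y<x. of_bool (visit \<omega> v \<sigma> (Inl y))) + (\<Sum>j<t. of_bool (visit \<omega> v \<sigma> (Inr j)))
       = (\<Sum>y<x. of_bool (\<sigma> (Inl y))) + (\<Sum>j<t. of_bool (\<sigma> (Inr j)) :: int)"
    by (simp del: sum_of_bool_eq)
  with Cons show ?case by (simp del: sum_of_bool_eq)
qed simp

text \<open>The intermediate configuration \<open>\<sigma>'\<close> has the bottom boundary of \<open>\<sigma>\<close> and the full left
  boundary of the step model, so it dominates both.\<close>

lemma height_ge_boundary:
  assumes "conservative \<omega>"
  shows "(\<Sum>j<t. of_bool (fold (visit \<omega>) (List.product [0..<x] [0..<t]) \<sigma> (Inr j)))
      - (\<Sum>y<x. of_bool (\<sigma> (Inl y))) \<le> s6v_height_nat \<omega> x t"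
proof -
  define F where "F = fold (visit \<omega>) (List.product [0..<x] [0..<t])"
  define \<sigma>' :: s6v_state where "\<sigma>' = case_sum (\<sigma> \<circ> Inl) (\<lambda>_. True)"
  have mono: "(\<Sum>i\<in>I. of_bool (F \<tau> (g i)) :: int) \<le> (\<Sum>i\<in>I. of_bool (F \<tau>' (g i)))"
    if "\<tau> \<le> \<tau>'" for \<tau> \<tau>' and I and g :: "nat \<Rightarrow> nat + nat"
    using fold_visit_mono[OF assms that] by (auto simp: F_def le_fun_def intro!: sum_mono)
  have "step_state \<le> \<sigma>'" "\<sigma> \<le> \<sigma>'"
    by (auto simp: step_state_def \<sigma>'_def le_fun_def split: sum.splits)
  \<comment> \<open>The step model has at most as many particles on top as the run from
    \<open>\<sigma>'\<close>, and the run from \<open>\<sigma>\<close> at most as many on the right.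
    Conservation for \<open>\<sigma>'\<close> links the two counts.\<close>
  note mono[OF this(1), of Inl "{..<x}"] mono[OF this(2), of Inr "{..<t}"]
  moreover have "(\<Sum>y<x. of_bool (F \<sigma>' (Inl y))) + (\<Sum>j<t. of_bool (F \<sigma>' (Inr j)))
       = (\<Sum>y<x. of_bool (\<sigma> (Inl y))) + int t"
    unfolding F_def by (subst fold_visit_conserved[OF assms]) (auto simp: \<sigma>'_def)
  moreover have "s6v_height_nat \<omega> x t = int t - (\<Sum>y<x. of_bool (F step_state (Inl y)))"
    by (simp add: F_def fold_visit_step s6v_height_nat_def)
  ultimately show ?thesis by (simp add: F_def)
qed

section \<open>Resampling and stationarity\<close>

text \<open>Pairs of a vertex and an input are countable, so it suffices to check one coordinate
  under its vertex law.\<close>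

lemma AE_conservative: "AE \<omega> in s6v_measure b1 b2. conservative \<omega>"
proof -
  have "AE \<omega> in s6v_measure b1 b2. of_bool (fst (\<omega> (v, i))) + of_bool (snd (\<omega> (v, i)))
     = (of_bool (fst i) + of_bool (snd i) :: int)" for v i
  proof -
    have "AE out in measure_pmf (s6v_vertex_law b1 b2 i). of_bool (fst out) + of_bool (snd out)
     = (of_bool (fst i) + of_bool (snd i) :: int)"
      by (auto simp: AE_measure_pmf_iff s6v_vertex_law_def split: prod.splits bool.splits if_splits)
    then have *: "AE out in (\<lambda>(_, i). measure_pmf (s6v_vertex_law b1 b2 i)) (v, i).
       of_bool (fst out) + of_bool (snd out) = (of_bool (fst i) + of_bool (snd i) :: int)"
      by (simp only: prod.case)
    show ?thesis
      unfolding s6v_measure_def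
      using AE_PiM_component[of UNIV "\<lambda>(_, i). measure_pmf (s6v_vertex_law b1 b2 i)" "(v, i)"
          "\<lambda>out. of_bool (fst out) + of_bool (snd out) = (of_bool (fst i) + of_bool (snd i) :: int)", OF _ UNIV_I *]
      by (simp add: prob_space_measure_pmf split_beta)
  qed
  then show ?thesis
    unfolding conservative_def AE_all_countable by blast
qed

text \<open>One coordinate of the product measure is independent of the others, so redrawing it
  leaves the measure unchanged.\<close>

lemma nn_integral_s6v_resample:
  assumes [measurable]: "F \<in> borel_measurable (s6v_measure b1 b2)"
  shows "(\<integral>\<^sup>+\<omega>. F \<omega> \<partial>s6v_measure b1 b2) =
    (\<integral>\<^sup>+out. (\<integral>\<^sup>+\<omega>. F (fun_upd \<omega> (v, i) out) \<partial>s6v_measure b1 b2) \<partial>s6v_vertex_law b1 b2 i)"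
proof -
  let ?P = "s6v_vertex_law b1 b2 i" and ?M = "s6v_measure b1 b2"
  interpret M: prob_space ?M by (rule prob_space_s6v_measure)
  have eq: "distr (measure_pmf ?P \<Otimes>\<^sub>M ?M) ?M (\<lambda>(out, \<omega>). fun_upd \<omega> (v, i) out) = ?M"
    using distr_pair_PiM_eq_PiM[of UNIV "\<lambda>(_, i). measure_pmf (s6v_vertex_law b1 b2 i)" "(v, i)"]
    by (auto simp: s6v_measure_def prob_space_measure_pmf)
  have meas[measurable]: "(\<lambda>(out, \<omega>). fun_upd \<omega> (v, i) out) \<in> measure_pmf ?P \<Otimes>\<^sub>M ?M \<rightarrow>\<^sub>M ?M"
    unfolding s6v_measure_def case_prod_unfold
    by (rule measurable_fun_upd[where J = UNIV]) auto
  have "(\<integral>\<^sup>+\<omega>. F \<omega> \<partial>?M) = (\<integral>\<^sup>+p. F (case p of (out, \<omega>) \<Rightarrow> fun_upd \<omega> (v, i) out) \<partial>(measure_pmf ?P \<Otimes>\<^sub>M ?M))"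
    by (subst eq[symmetric], subst nn_integral_distr) auto
  also have "\<dots> = (\<integral>\<^sup>+out. (\<integral>\<^sup>+\<omega>. F (fun_upd \<omega> (v, i) out) \<partial>?M) \<partial>?P)"
    by (subst M.nn_integral_fst[symmetric]) auto
  finally show ?thesis .
qed

lemma fold_visit_fun_upd:
  "v \<notin> set vs \<Longrightarrow> fold (visit (fun_upd \<omega> (v, i) out)) vs \<sigma> = fold (visit \<omega>) vs \<sigma>"
  by (induction vs arbitrary: \<sigma>) (auto simp: visit_def)

lemma measurable_fold_visit:
  "(\<lambda>\<omega>. fold (visit \<omega>) vs \<sigma>) \<in> s6v_measure b1 b2 \<rightarrow>\<^sub>M count_space UNIV"
proof (induction vs arbitrary: \<sigma>)
  case (Cons v vs)
  have "(\<lambda>\<omega>. \<omega> (v, get_vertex v \<sigma>)) \<in> s6v_measure b1 b2 \<rightarrow>\<^sub>M count_space UNIV"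
    unfolding get_vertex_def by (rule measurable_s6v_outcome) auto
  from measurable_compose_countable[OF _ this, of "\<lambda>out \<omega>. fold (visit \<omega>) vs (set_vertex v out \<sigma>)"]
  show ?case using Cons.IH by (simp add: visit_def[of _ v])
qed simp

text \<open>As no vertex recurs in \<open>vs\<close>, its outcome is fresh when visited; each visit
  then acts as a Markov kernel preserving \<open>\<pi>\<close>, and the first one can be integrated
  out.\<close>

lemma nn_integral_fold_visit_stationary:
  fixes f :: "s6v_state \<Rightarrow> ennreal"
  assumes "distinct vs"
    and stat: "\<And>v. v \<in> set vs \<Longrightarrow>
      bind_pmf \<pi> (\<lambda>\<sigma>. map_pmf (\<lambda>out. set_vertex v out \<sigma>) (s6v_vertex_law b1 b2 (get_vertex v \<sigma>))) = \<pi>"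
  shows "(\<integral>\<^sup>+\<sigma>. (\<integral>\<^sup>+\<omega>. f (fold (visit \<omega>) vs \<sigma>) \<partial>s6v_measure b1 b2) \<partial>\<pi>) = (\<integral>\<^sup>+\<sigma>. f \<sigma> \<partial>\<pi>)"
  using assms
proof (induction vs)
  case Nil
  interpret prob_space "s6v_measure b1 b2" by (rule prob_space_s6v_measure)
  show ?case by (simp add: emeasure_space_1)
next
  case (Cons v vs)
  let ?M = "s6v_measure b1 b2"
  define G where "G \<sigma> = (\<integral>\<^sup>+\<omega>. f (fold (visit \<omega>) vs \<sigma>) \<partial>?M)" for \<sigma>
  have "(\<integral>\<^sup>+\<omega>. f (fold (visit \<omega>) (v # vs) \<sigma>) \<partial>?M) =
      (\<integral>\<^sup>+out. G (set_vertex v out \<sigma>) \<partial>s6v_vertex_law b1 b2 (get_vertex v \<sigma>))" for \<sigma>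
  proof -
    have "(\<lambda>\<omega>. f (fold (visit \<omega>) (v # vs) \<sigma>)) \<in> borel_measurable ?M"
      by (rule measurable_compose[OF measurable_fold_visit]) simp
    from nn_integral_s6v_resample[OF this, where v = v and i = "get_vertex v \<sigma>"] show ?thesis
      using Cons.prems(1) by (simp add: visit_def[of _ v] fold_visit_fun_upd G_def)
  qed
  then have "(\<integral>\<^sup>+\<sigma>. (\<integral>\<^sup>+\<omega>. f (fold (visit \<omega>) (v # vs) \<sigma>) \<partial>?M) \<partial>\<pi>) =
     (\<integral>\<^sup>+\<sigma>. G \<sigma> \<partial>bind_pmf \<pi> (\<lambda>\<sigma>. map_pmf (\<lambda>out. set_vertex v out \<sigma>) (s6v_vertex_law b1 b2 (get_vertex v \<sigma>))))"
    by (simp add: nn_integral_bind_pmf)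
  also have "\<dots> = (\<integral>\<^sup>+\<sigma>. G \<sigma> \<partial>\<pi>)"
    using Cons.prems(2)[of v] by simp
  also have "\<dots> = (\<integral>\<^sup>+\<sigma>. f \<sigma> \<partial>\<pi>)"
    unfolding G_def using Cons by simp
  finally show ?case .
qed

definition boundary_pmf :: "real \<Rightarrow> real \<Rightarrow> nat \<Rightarrow> nat \<Rightarrow> s6v_state pmf" where
  "boundary_pmf p q x t = Pi_pmf ({..<x} <+> {..<t}) False
     (\<lambda>e. bernoulli_pmf (case e of Inl _ \<Rightarrow> p | Inr _ \<Rightarrow> q))"

text \<open>\<open>bal\<close> equates the mass of lone left particles that turn up with that of
  lone bottom particles that turn right, so the exchanges between the two one-particle states
  cancel.\<close>

lemma s6v_vertex_law_stationary:
  assumes "0 \<le> b1" "b1 \<le> 1" "0 \<le> b2" "b2 \<le> 1" "0 \<le> p" "p \<le> 1" "0 \<le> q" "q \<le> 1"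
    and bal: "(1 - b2) * q * (1 - p) = (1 - b1) * p * (1 - q)"
  shows "bind_pmf (pair_pmf (bernoulli_pmf p) (bernoulli_pmf q)) (s6v_vertex_law b1 b2)
    = pair_pmf (bernoulli_pmf p) (bernoulli_pmf q)"
proof (rule pmf_eqI)
  fix i :: "bool \<times> bool"
  obtain a b where i: "i = (a, b)" by fastforce
  show "pmf (bind_pmf (pair_pmf (bernoulli_pmf p) (bernoulli_pmf q)) (s6v_vertex_law b1 b2)) i
    = pmf (pair_pmf (bernoulli_pmf p) (bernoulli_pmf q)) i"
    using assms unfolding i pair_pmf_def bind_assoc_pmf bind_return_pmf s6v_vertex_law_def
    by (cases a; cases b) (simp_all add: pmf_bind integral_bernoulli_pmf map_pmf_def algebra_simps)
qed

lemma boundary_pmf_stationary: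
  assumes "0 \<le> b1" "b1 \<le> 1" "0 \<le> b2" "b2 \<le> 1" "0 \<le> p" "p \<le> 1" "0 \<le> q" "q \<le> 1"
    and bal: "(1 - b2) * q * (1 - p) = (1 - b1) * p * (1 - q)"
    and v: "v \<in> {..<x} \<times> {..<t}"
  shows "bind_pmf (boundary_pmf p q x t)
      (\<lambda>\<sigma>. map_pmf (\<lambda>out. set_vertex v out \<sigma>) (s6v_vertex_law b1 b2 (get_vertex v \<sigma>)))
    = boundary_pmf p q x t"
proof -
  define A :: "(nat + nat) set" where "A = ({..<x} <+> {..<t}) - {Inl (fst v), Inr (snd v)}"
  let ?law = "\<lambda>e :: nat + nat. bernoulli_pmf (case e of Inl _ \<Rightarrow> p | Inr _ \<Rightarrow> q)"
  let ?R = "Pi_pmf A False ?law"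
  have "{..<x} <+> {..<t} = insert (Inr (snd v)) (insert (Inl (fst v)) A)"
    using v by (auto simp: A_def)
  moreover have "Inr (snd v) \<notin> insert (Inl (fst v)) A" "Inl (fst v) \<notin> A" "finite A"
    by (auto simp: A_def)
  ultimately have "boundary_pmf p q x t = do {\<tau> \<leftarrow> ?R; i \<leftarrow> pair_pmf (bernoulli_pmf p) (bernoulli_pmf q);
      return_pmf (set_vertex v i \<tau>)}" (is "_ = ?B")
    \<comment> \<open>The insertions draw the left input first, then the bottom one, then the other
      edges; independence permits the reversed order of \<open>?B\<close>.\<close>
    unfolding boundary_pmf_def
    by (simp add: Pi_pmf_insert' pair_pmf_def bind_assoc_pmf bind_return_pmf set_vertex_def)
      (simp only: bind_commute_pmf[of "bernoulli_pmf p" ?R] bind_commute_pmf[of "bernoulli_pmf q" ?R]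
        bind_commute_pmf[of "bernoulli_pmf q" "bernoulli_pmf p"])
  note B = this
  have "bind_pmf ?B (\<lambda>\<sigma>. map_pmf (\<lambda>out. set_vertex v out \<sigma>) (s6v_vertex_law b1 b2 (get_vertex v \<sigma>)))
    = do {\<tau> \<leftarrow> ?R; out \<leftarrow> bind_pmf (pair_pmf (bernoulli_pmf p) (bernoulli_pmf q)) (s6v_vertex_law b1 b2);
      return_pmf (set_vertex v out \<tau>)}"
    by (simp add: bind_assoc_pmf bind_return_pmf map_pmf_def set_vertex_def get_vertex_def fun_upd_twist)
  also have "\<dots> = ?B"
    by (simp only: s6v_vertex_law_stationary[OF assms(1-9)])
  finally show ?thesis using B by simp
qed

section \<open>Bounds for logarithm, exponential and Bernoulli cumulants\<close>

lemma ln_one_minus_le: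
  fixes y :: real
  assumes "0 \<le> y" "y < 1"
  shows "ln (1 - y) \<le> - y - y\<^sup>2 / 2"
proof -
  let ?f = "\<lambda>y::real. ln (1 - y) + y + y\<^sup>2 / 2"
  have "?f y \<le> ?f 0"
  proof (rule DERIV_nonpos_imp_nonincreasing[OF assms(1)])
    fix z :: real assume "0 \<le> z" "z \<le> y"
    with assms have "(?f has_real_derivative - z\<^sup>2 / (1 - z)) (at z)" "- z\<^sup>2 / (1 - z) \<le> 0"
      by (auto intro!: derivative_eq_intros simp: field_simps power2_eq_square)
    then show "\<exists>d. (?f has_real_derivative d) (at z) \<and> d \<le> 0" by blast
  qed
  then show ?thesis by simp
qed

text \<open>The unit coefficient of the cube gives the derivative the factor
  \<open>2 - 3 * z\<close>, whence the range up to \<open>2 / 3\<close>.\<close>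

lemma ln_one_minus_ge:
  fixes y :: real
  assumes "0 \<le> y" "y \<le> 2 / 3"
  shows "- y - y\<^sup>2 / 2 - y ^ 3 \<le> ln (1 - y)"
proof -
  let ?f = "\<lambda>y::real. ln (1 - y) + y + y\<^sup>2 / 2 + y ^ 3"
  have "?f 0 \<le> ?f y"
  proof (rule DERIV_nonneg_imp_nondecreasing[OF assms(1)])
    fix z :: real assume "0 \<le> z" "z \<le> y"
    with assms have "(?f has_real_derivative z\<^sup>2 * (2 - 3 * z) / (1 - z)) (at z)"
      by (auto intro!: derivative_eq_intros simp: field_simps power2_eq_square)
    moreover have "z\<^sup>2 * (2 - 3 * z) / (1 - z) \<ge> 0"
      using assms \<open>z \<le> y\<close> by simp
    ultimately show "\<exists>d. (?f has_real_derivative d) (at z) \<and> 0 \<le> d" by blast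
  qed
  then show ?thesis by simp
qed

lemma exp_minus_le_quadratic:
  fixes l :: real
  assumes "0 \<le> l"
  shows "exp (- l) \<le> 1 - l + l\<^sup>2 / 2"
proof -
  let ?f = "\<lambda>l::real. 1 - l + l\<^sup>2 / 2 - exp (- l)"
  have "?f 0 \<le> ?f l"
  proof (rule DERIV_nonneg_imp_nondecreasing[OF assms(1)])
    fix z :: real
    have "(?f has_real_derivative exp (- z) - (1 - z)) (at z)" "0 \<le> exp (- z) - (1 - z)"
      using exp_ge_add_one_self[of "- z"] by (auto intro!: derivative_eq_intros)
    then show "\<exists>d. (?f has_real_derivative d) (at z) \<and> 0 \<le> d" by blast
  qed
  then show ?thesis by simp
qed

lemma exp_minus_ge_cubic:
  fixes l :: real
  assumes "0 \<le> l"
  shows "1 - l + l\<^sup>2 / 2 - l ^ 3 / 6 \<le> exp (- l)"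
proof -
  let ?f = "\<lambda>l::real. exp (- l) - (1 - l + l\<^sup>2 / 2 - l ^ 3 / 6)"
  have "?f 0 \<le> ?f l"
  proof (rule DERIV_nonneg_imp_nondecreasing[OF assms(1)])
    fix z :: real assume "0 \<le> z"
    then have "(?f has_real_derivative 1 - z + z\<^sup>2 / 2 - exp (- z)) (at z)" "0 \<le> 1 - z + z\<^sup>2 / 2 - exp (- z)"
      using exp_minus_le_quadratic[of z] by (auto intro!: derivative_eq_intros)
    then show "\<exists>d. (?f has_real_derivative d) (at z) \<and> 0 \<le> d" by blast
  qed
  then show ?thesis by simp
qed

lemma bernoulli_laplace_pos:
  fixes p l :: real
  assumes "0 \<le> p" "p \<le> 1" "0 \<le> l"
  shows "0 < 1 - p * (1 - exp (- l))"
proof -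
  have "p * (1 - exp (- l)) \<le> 1 * (1 - exp (- l))"
    using assms by (intro mult_right_mono) auto
  also have "\<dots> < 1" by simp
  finally show ?thesis by simp
qed

lemma bernoulli_cumulant_le:
  fixes p l :: real
  assumes "0 \<le> p" "p \<le> 1" "0 \<le> l" "l \<le> 1"
  shows "ln (1 - p * (1 - exp (- l))) \<le> - p * l + p * (1 - p) * l\<^sup>2 / 2 + l ^ 3 / 2"
proof -
  define r where "r = 1 - exp (- l)"
  have r: "l - l\<^sup>2 / 2 \<le> r" "r < 1" 
    using exp_minus_le_quadratic[of l] assms by (auto simp: r_def)
  have "l\<^sup>2 \<le> l"
    using assms by (simp add: power2_eq_square mult_left_le)
  with assms have l2: "0 \<le> l - l\<^sup>2 / 2" by linarith
  \<comment> \<open>\<open>- y - y^2 / 2\<close> decreases for \<open>y \<ge> 0\<close>, so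
    \<open>p * r\<close> may be replaced by the smaller polynomial \<open>z\<close>.\<close>
  define z where "z = p * (l - l\<^sup>2 / 2)"
  have z: "0 \<le> z" "z \<le> p * r" 
    using assms l2 r by (auto simp: z_def intro!: mult_left_mono)
  have "p * r < 1"
    using r l2 assms by (smt (verit) mult_left_le_one_le)
  have "ln (1 - p * r) \<le> - (p * r) - (p * r)\<^sup>2 / 2"
    using ln_one_minus_le[of "p * r"] z \<open>p * r < 1\<close> by simp
  also have "\<dots> \<le> - z - z\<^sup>2 / 2"
    using z power_mono[of z "p * r" 2] by linarith
  also have "\<dots> = - p * l + p * (1 - p) * l\<^sup>2 / 2 + p\<^sup>2 * l ^ 3 / 2 - p\<^sup>2 * l ^ 4 / 8"
    by (simp add: z_def field_simps power2_eq_square power3_eq_cube power4_eq_xxxx)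
  also have "\<dots> \<le> - p * l + p * (1 - p) * l\<^sup>2 / 2 + l ^ 3 / 2"
  proof -
    have "p\<^sup>2 * l ^ 3 \<le> 1 * l ^ 3" "0 \<le> p\<^sup>2 * l ^ 4"
      using assms by (intro mult_right_mono) (auto simp: power_le_one)
    then show ?thesis by linarith
  qed
  finally show ?thesis by (simp add: r_def)
qed

lemma bernoulli_cumulant_ge:
  fixes p l :: real
  assumes "0 \<le> p" "p \<le> 1" "0 \<le> l" "l \<le> 1"
  shows "- p * l + p * (1 - p) * l\<^sup>2 / 2 - 2 * l ^ 3 \<le> ln (1 - p * (1 - exp (- l)))"
proof -
  define r where "r = 1 - exp (- l)"
  \<comment> \<open>This crude bound brings \<open>r\<close> into the range of
    \<open>ln_one_minus_ge\<close>.\<close>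
  have "exp (1::real) \<le> 3" by (rule exp_le)
  then have "inverse 3 \<le> exp (- 1 :: real)"
    unfolding exp_minus by (intro le_imp_inverse_le) auto
  also have "\<dots> \<le> exp (- l)" using assms by simp
  finally have r1: "r \<le> 2 / 3" by (simp add: r_def)
  have r0: "0 \<le> r" using assms by (simp add: r_def)
  have r2: "r \<le> l" using exp_ge_add_one_self[of "- l"] by (simp add: r_def)
  have r3: "r \<le> l - l\<^sup>2 / 2 + l ^ 3 / 6" using exp_minus_ge_cubic[of l] assms by (simp add: r_def)
  have y: "0 \<le> p * r" "p * r \<le> r" 
    using assms r0 by (auto simp: mult_left_le_one_le)
  have e1: "p * r \<le> p * l - p * l\<^sup>2 / 2 + l ^ 3 / 6"
    using mult_left_mono[OF r3 assms(1)] mult_right_mono[of p 1 "l ^ 3"] assms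
    by (simp add: algebra_simps)
  have e2: "(p * r)\<^sup>2 \<le> p\<^sup>2 * l\<^sup>2"
    using assms r0 r2 by (simp add: power_mult_distrib mult_left_mono power_mono)
  have expand: "p * (1 - p) * l\<^sup>2 / 2 = p * l\<^sup>2 / 2 - p\<^sup>2 * l\<^sup>2 / 2"
    by (simp add: field_simps power2_eq_square)
  have e3: "(p * r) ^ 3 \<le> l ^ 3"
    using y r2 by (intro power_mono) auto
  \<comment> \<open>The cubic losses are \<open>l ^ 3 / 6\<close> from \<open>e1\<close> and
    \<open>l ^ 3\<close> from \<open>e3\<close>; the constant 2 leaves room.\<close>
  have "- p * l + p * (1 - p) * l\<^sup>2 / 2 - 2 * l ^ 3 \<le> - (p * r) - (p * r)\<^sup>2 / 2 - (p * r) ^ 3"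
    using e1 e2 e3 zero_le_power[OF assms(3), of 3] expand by linarith
  also have "\<dots> \<le> ln (1 - p * r)"
    using y r1 by (intro ln_one_minus_ge) auto
  finally show ?thesis by (simp add: r_def)
qed

section \<open>Balanced boundary densities\<close>

text \<open>The maximiser of \<open>q - \<mu> p\<close> subject to \<open>q (1 - p) = \<kappa> p (1 - q)\<close>.\<close>

definition balanced_density :: "real \<Rightarrow> real \<Rightarrow> real" where
  "balanced_density \<kappa> \<mu> = (sqrt (\<kappa> / \<mu>) - 1) / (\<kappa> - 1)"

text \<open>In \<open>a = sqrt \<kappa>\<close> and \<open>m = sqrt \<mu>\<close> the claims become
  rational identities and sign conditions. \<open>p\<close> and \<open>q\<close> are nonnegative
  because \<open>m \<le> a\<close>, \<open>1 - p\<close> and \<open>1 - q\<close> because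
  \<open>1 \<le> a * m\<close>: these are the two ends of the range of \<open>\<mu>\<close>.\<close>

lemma balanced_density:
  fixes \<kappa> \<mu> :: real
  assumes "1 < \<kappa>" "inverse \<kappa> \<le> \<mu>" "\<mu> \<le> \<kappa>"
  defines "p \<equiv> balanced_density \<kappa> \<mu>" and "q \<equiv> sqrt (\<kappa> * \<mu>) * balanced_density \<kappa> \<mu>"
  shows "0 \<le> p" "p \<le> 1" "0 \<le> q" "q \<le> 1"
    and "q * (1 - p) = \<kappa> * p * (1 - q)"
    and "q - \<mu> * p = s6v_limit_shape \<kappa> \<mu>"
    and "q * (1 - q) = \<mu> * p * (1 - p)"
proof -
  define a m where "a = sqrt \<kappa>" and "m = sqrt \<mu>"
  have "0 < inverse \<kappa>" using assms(1) by simp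
  then have pos: "0 < \<mu>" "0 < \<kappa>" using assms(1,2) by linarith+
  have am: "0 < m" "1 < a" "\<mu> = m\<^sup>2" "\<kappa> = a\<^sup>2"
    using pos assms(1) by (auto simp: a_def m_def)
  have "1 \<le> \<kappa> * \<mu>" using assms(2) pos by (simp add: field_simps)
  then have "1 \<le> sqrt (\<kappa> * \<mu>)" by simp
  then have b1: "1 \<le> a * m" by (simp add: a_def m_def real_sqrt_mult)
  have b2: "m \<le> a" using assms(3) by (simp add: a_def m_def)
  have a2: "0 < a\<^sup>2 - 1" using assms(1) am by simp
  have p: "p = (a - m) / (m * (a\<^sup>2 - 1))"
    using am a2 by (simp add: p_def balanced_density_def real_sqrt_divide field_simps)
  have "q = a * m * p"
    by (simp add: q_def p_def a_def m_def real_sqrt_mult)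
  then have q: "q = a * (a - m) / (a\<^sup>2 - 1)"
    using am by (simp add: p)
  have p': "1 - p = a * (a * m - 1) / (m * (a\<^sup>2 - 1))"
    using am a2 by (simp add: p field_simps power2_eq_square)
  have q': "1 - q = (a * m - 1) / (a\<^sup>2 - 1)"
    using am a2 by (simp add: q field_simps power2_eq_square)
  show "0 \<le> p" "0 \<le> q"
    using am b2 a2 by (auto simp: p q)
  have "0 \<le> 1 - p" "0 \<le> 1 - q"
    unfolding p' q' using am b1 a2 by auto
  then show "p \<le> 1" "q \<le> 1" by auto
  show "q * (1 - p) = \<kappa> * p * (1 - q)" 
    unfolding p' q' unfolding p q am using am a2 by (simp add: divide_simps power2_eq_square)
  show "q * (1 - q) = \<mu> * p * (1 - p)"
    unfolding p' q' unfolding p q am using am a2 by (simp add: divide_simps power2_eq_square)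
  show "q - \<mu> * p = s6v_limit_shape \<kappa> \<mu>"
    unfolding s6v_limit_shape_def a_def[symmetric] m_def[symmetric]
    unfolding p q am using am a2 by (simp add: divide_simps) (simp add: algebra_simps power2_eq_square)
qed

section \<open>Laplace transform and lower tail of the height\<close>

lemma nn_integral_boundary_pmf:
  assumes "0 \<le> p" "p \<le> 1" "0 \<le> q" "q \<le> 1" "0 \<le> l"
  shows "(\<integral>\<^sup>+\<sigma>. ennreal (exp (- l * (\<Sum>y<x. of_bool (\<sigma> (Inl y))))) \<partial>boundary_pmf p q x t)
      = ennreal ((1 - p * (1 - exp (- l))) ^ x)" (is "?P")
    and "(\<integral>\<^sup>+\<sigma>. ennreal (exp (- l * (\<Sum>j<t. of_bool (\<sigma> (Inr j))))) \<partial>boundary_pmf p q x t)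
      = ennreal ((1 - q * (1 - exp (- l))) ^ t)" (is "?Q")
proof -
  \<comment> \<open>A product formula for general edge weights; weight 1 on one side of the boundary
    leaves only the count on the other.\<close>
  have *: "(\<integral>\<^sup>+\<sigma>. (\<Prod>e\<in>{..<x} <+> {..<t}. w e (\<sigma> e)) \<partial>boundary_pmf p q x t)
      = (\<Prod>y<x. \<integral>\<^sup>+b. w (Inl y) b \<partial>bernoulli_pmf p) * (\<Prod>j<t. \<integral>\<^sup>+b. w (Inr j) b \<partial>bernoulli_pmf q)"
    for w :: "nat + nat \<Rightarrow> bool \<Rightarrow> ennreal"
    unfolding boundary_pmf_def by (subst nn_integral_prod_Pi_pmf) (simp_all add: prod.Plus)
  have r: "0 \<le> 1 - r * (1 - exp (- l))" if "0 \<le> r" "r \<le> 1" for r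
    using bernoulli_laplace_pos[OF that assms(5)] by simp
  have e: "ennreal (exp (- l * (\<Sum>i\<in>I. of_bool (b i)))) = (\<Prod>i\<in>I. ennreal (exp (- l * of_bool (b i))))"
    if "finite I" for I :: "nat set" and b
    using that by (simp add: sum_distrib_left exp_sum prod_ennreal del: sum_of_bool_eq)
  have ber: "ennreal (exp (- l)) * ennreal r + ennreal (1 - r) = ennreal (1 - r * (1 - exp (- l)))"
    if "0 \<le> r" "r \<le> 1" for r
    using that by (simp add: ennreal_mult[symmetric] ennreal_plus[symmetric] algebra_simps del: ennreal_plus)
  show ?P
    using *[of "\<lambda>e b. case e of Inl _ \<Rightarrow> ennreal (exp (- l * of_bool b)) | Inr _ \<Rightarrow> 1"] assms r[of p]
    unfolding e[OF finite_lessThan]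
    by (simp add: prod.Plus ber ennreal_power)
  show ?Q
    using *[of "\<lambda>e b. case e of Inr _ \<Rightarrow> ennreal (exp (- l * of_bool b)) | Inl _ \<Rightarrow> 1"] assms r[of q]
    unfolding e[OF finite_lessThan]
    by (simp add: prod.Plus ber ennreal_power)
qed

lemma height_laplace_le:
  fixes b1 b2 p q l :: real
  assumes "0 \<le> b1" "b1 \<le> 1" "0 \<le> b2" "b2 \<le> 1" "0 \<le> p" "p \<le> 1" "0 \<le> q" "q \<le> 1"
    and bal: "(1 - b2) * q * (1 - p) = (1 - b1) * p * (1 - q)"
    and "0 \<le> l"
  shows "(\<integral>\<^sup>+\<omega>. ennreal (exp (- l * s6v_height_nat \<omega> x t)) \<partial>s6v_measure b1 b2)
      \<le> ennreal ((1 - q * (1 - exp (- l))) ^ t / (1 - p * (1 - exp (- l))) ^ x)"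
proof -
  let ?M = "s6v_measure b1 b2" and ?B = "boundary_pmf p q x t"
  let ?F = "\<lambda>\<omega>. fold (visit \<omega>) (List.product [0..<x] [0..<t])"
  let ?E = "\<integral>\<^sup>+\<omega>. ennreal (exp (- l * s6v_height_nat \<omega> x t)) \<partial>?M"
  define h where "h \<sigma> = ennreal (exp (- l * (\<Sum>j<t. of_bool (\<sigma> (Inr j)))))" for \<sigma> :: s6v_state
  define g where "g \<sigma> = ennreal (exp (- l * (\<Sum>y<x. of_bool (\<sigma> (Inl y)))))" for \<sigma> :: s6v_state
  have m: "(\<lambda>\<omega>. ennreal (exp (- l * s6v_height_nat \<omega> x t))) \<in> borel_measurable ?M"
    using measurable_compose[OF measurable_s6v_height[of "real x" "real t" b1 b2], of "\<lambda>h. ennreal (exp (- l * of_int h))" borel]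
    by (simp add: s6v_height_def)
  \<comment> \<open>The boundary state is fixed and \<open>?E\<close> does not depend on it: here
    the independence of the height and the bottom boundary enters.\<close>
  have "g \<sigma> * ?E \<le> (\<integral>\<^sup>+\<omega>. h (?F \<omega> \<sigma>) \<partial>?M)" for \<sigma>
  proof -
    have "g \<sigma> * ?E = (\<integral>\<^sup>+\<omega>. g \<sigma> * ennreal (exp (- l * s6v_height_nat \<omega> x t)) \<partial>?M)"
      using m by (simp add: nn_integral_cmult)
    also have "\<dots> \<le> (\<integral>\<^sup>+\<omega>. h (?F \<omega> \<sigma>) \<partial>?M)"
    proof (rule nn_integral_mono_AE, use AE_conservative in eventually_elim)
      case (elim \<omega>)
      have "real_of_int ((\<Sum>j<t. of_bool (?F \<omega> \<sigma> (Inr j))) - (\<Sum>y<x. of_bool (\<sigma> (Inl y))))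
          \<le> real_of_int (s6v_height_nat \<omega> x t)"
        using height_ge_boundary[OF elim] by (rule of_int_le_iff[THEN iffD2])
      from mult_left_mono[OF this \<open>0 \<le> l\<close>] show ?case
        by (auto simp: g_def h_def ennreal_mult[symmetric] exp_add[symmetric] algebra_simps)
    qed
    finally show ?thesis .
  qed
  then have "(\<integral>\<^sup>+\<sigma>. g \<sigma> * ?E \<partial>?B) \<le> (\<integral>\<^sup>+\<sigma>. (\<integral>\<^sup>+\<omega>. h (?F \<omega> \<sigma>) \<partial>?M) \<partial>?B)"
    by (intro nn_integral_mono)
  \<comment> \<open>By stationarity the edges leaving on the right have the law of those entering on
    the left.\<close>
  also have "\<dots> = (\<integral>\<^sup>+\<sigma>. h \<sigma> \<partial>?B)"
    by (rule nn_integral_fold_visit_stationary)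
       (auto intro!: distinct_product boundary_pmf_stationary[OF assms(1-9)])
  also have "\<dots> = ennreal ((1 - q * (1 - exp (- l))) ^ t)"
    unfolding h_def by (rule nn_integral_boundary_pmf(2)[OF assms(5-8,10)])
  finally have "(\<integral>\<^sup>+\<sigma>. g \<sigma> \<partial>?B) * ?E \<le> ennreal ((1 - q * (1 - exp (- l))) ^ t)"
    by (simp add: nn_integral_multc)
  then have *: "ennreal ((1 - p * (1 - exp (- l))) ^ x) * ?E \<le> ennreal ((1 - q * (1 - exp (- l))) ^ t)"
    unfolding g_def nn_integral_boundary_pmf(1)[OF assms(5-8,10)] .
  have pos: "0 < 1 - p * (1 - exp (- l))"
    using assms(5,6,10) by (rule bernoulli_laplace_pos)
  then have "?E = ennreal ((1 - p * (1 - exp (- l))) ^ x) * ?E / ennreal ((1 - p * (1 - exp (- l))) ^ x)"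
    by (subst ennreal_mult_divide_eq[symmetric]) (auto simp: mult.commute)
  also have "\<dots> \<le> ennreal ((1 - q * (1 - exp (- l))) ^ t) / ennreal ((1 - p * (1 - exp (- l))) ^ x)"
    using * by (rule divide_right_mono_ennreal)
  also have "\<dots> = ennreal ((1 - q * (1 - exp (- l))) ^ t / (1 - p * (1 - exp (- l))) ^ x)"
    using pos bernoulli_laplace_pos[OF assms(7,8,10)] by (intro divide_ennreal) auto
  finally show ?thesis .
qed

lemma height_tail_le:
  fixes b1 b2 \<kappa> \<mu> s :: real and T :: nat
  assumes b: "0 < b1" "b1 < b2" "b2 < 1" "\<kappa> = s6v_kappa b1 b2"
    and \<mu>: "inverse \<kappa> \<le> \<mu>" "\<mu> \<le> \<kappa>" and T: "T \<ge> 1"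
  shows "\<P>(\<omega> in s6v_measure b1 b2. real_of_int (s6v_height \<omega> (real T * \<mu>) (real T))
        \<le> s6v_limit_shape \<kappa> \<mu> * real T - s * real T powr (1 / 3))
      \<le> exp (1 / 2 + 2 * \<kappa>) * exp (- s)"
proof -
  interpret prob_space "s6v_measure b1 b2" by (rule prob_space_s6v_measure)
  have \<kappa>: "1 < \<kappa>" using b by (simp add: s6v_kappa_def)
  define p where "p = balanced_density \<kappa> \<mu>"
  define q where "q = sqrt (\<kappa> * \<mu>) * balanced_density \<kappa> \<mu>"
  note d = balanced_density[OF \<kappa> \<mu>, folded q_def, folded p_def]
  have bal: "(1 - b2) * q * (1 - p) = (1 - b1) * p * (1 - q)"
  proof -
    have "q * (1 - p) = \<kappa> * (p * (1 - q))"
      using d(5) by (simp only: mult.assoc)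
    moreover have "1 - b1 = (1 - b2) * \<kappa>"
      using b by (simp add: s6v_kappa_def)
    ultimately show ?thesis by (simp only: mult.assoc)
  qed
  \<comment> \<open>With this choice \<open>T * l ^ 3\<close> and \<open>l * T powr (1 / 3)\<close>
    both equal 1: the cubic error stays bounded and the deviation contributes exactly
    \<open>- s\<close>.\<close>
  define l where "l = real T powr (- (1 / 3))"
  have "l ^ 3 = real T powr (- 1)"
    using T by (simp add: l_def powr_power)
  then have l3: "real T * l ^ 3 = 1"
    using T by (simp add: powr_minus)
  have "real T powr (- (1 / 3)) \<le> real T powr 0"
    using T by (intro powr_mono) auto
  then have l: "0 < l" "l \<le> 1"
    using T by (simp_all add: l_def)
  have l1: "l * real T powr (1 / 3) = 1"
    using T by (simp add: l_def powr_add[symmetric])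
  define x where "x = nat \<lfloor>real T * \<mu>\<rfloor>"
  define A where "A = 1 - q * (1 - exp (- l))"
  define B where "B = 1 - p * (1 - exp (- l))"
  define a where "a = s6v_limit_shape \<kappa> \<mu> * real T - s * real T powr (1 / 3)"
  have "0 < \<mu>" using \<mu>(1) \<kappa> by (smt (verit) positive_imp_inverse_positive)
  have x: "real x \<le> real T * \<mu>"
    using \<open>0 < \<mu>\<close> by (simp add: x_def)
  have AB: "0 < A" "0 < B" "B \<le> 1"
    using bernoulli_laplace_pos[of p l] bernoulli_laplace_pos[of q l] d(1-4) l by (auto simp: A_def B_def)
  have "ln A \<le> - q * l + q * (1 - q) * l\<^sup>2 / 2 + l ^ 3 / 2"
    unfolding A_def using d(1-4) l by (intro bernoulli_cumulant_le) auto
  moreover have "\<mu> * (- p * l + p * (1 - p) * l\<^sup>2 / 2 - 2 * l ^ 3) \<le> \<mu> * ln B"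
    unfolding B_def using d(1-4) l \<open>0 < \<mu>\<close> by (intro mult_left_mono bernoulli_cumulant_ge) auto
  moreover have "- q * l + q * (1 - q) * l\<^sup>2 / 2 + l ^ 3 / 2 - \<mu> * (- p * l + p * (1 - p) * l\<^sup>2 / 2 - 2 * l ^ 3)
      = - (q - \<mu> * p) * l + (q * (1 - q) - \<mu> * p * (1 - p)) * l\<^sup>2 / 2 + (1 / 2 + 2 * \<mu>) * l ^ 3"
    by (simp add: field_simps)
  \<comment> \<open>The balanced densities turn the linear coefficient into the limit shape and
    cancel the quadratic one.\<close>
  moreover have "\<dots> = - s6v_limit_shape \<kappa> \<mu> * l + (1 / 2 + 2 * \<mu>) * l ^ 3"
    by (simp only: d(6,7)) simp
  ultimately have "ln A - \<mu> * ln B \<le> - s6v_limit_shape \<kappa> \<mu> * l + (1 / 2 + 2 * \<mu>) * l ^ 3"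
    by linarith
  then have "real T * (ln A - \<mu> * ln B) \<le> real T * (- s6v_limit_shape \<kappa> \<mu> * l + (1 / 2 + 2 * \<mu>) * l ^ 3)"
    by (rule mult_left_mono) simp
  also have "\<dots> = - (s6v_limit_shape \<kappa> \<mu> * (real T * l)) + (1 / 2 + 2 * \<mu>) * (real T * l ^ 3)"
    by (simp add: algebra_simps)
  finally have "real T * (ln A - \<mu> * ln B) \<le> - (s6v_limit_shape \<kappa> \<mu> * (real T * l)) + (1 / 2 + 2 * \<mu>)"
    unfolding l3 by simp
  \<comment> \<open>Since \<open>ln B \<le> 0\<close>, rounding \<open>T * \<mu>\<close> down to
    \<open>x\<close> only helps.\<close>
  moreover have "real T * \<mu> * ln B \<le> real x * ln B"
    using x AB by (intro mult_right_mono_neg) auto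
  moreover have "l * a = s6v_limit_shape \<kappa> \<mu> * real T * l - s * (l * real T powr (1 / 3))"
    by (simp add: a_def algebra_simps)
  ultimately have expo: "l * a + (real T * ln A - real x * ln B) \<le> 1 / 2 + 2 * \<kappa> - s"
    using \<mu>(2) by (simp only: l1 right_diff_distrib mult.assoc)
  have m: "(\<lambda>\<omega>. real_of_int (s6v_height_nat \<omega> x T)) \<in> borel_measurable (s6v_measure b1 b2)"
    using measurable_compose[OF measurable_s6v_height[of "real x" "real T" b1 b2], of real_of_int borel]
    by (simp add: s6v_height_def)
  have "emeasure (s6v_measure b1 b2) {\<omega> \<in> space (s6v_measure b1 b2). real_of_int (s6v_height_nat \<omega> x T) \<le> a}
      \<le> ennreal (exp (l * a)) * (\<integral>\<^sup>+\<omega>. ennreal (exp (- l * s6v_height_nat \<omega> x T))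
          * indicator (space (s6v_measure b1 b2)) \<omega> \<partial>s6v_measure b1 b2)"
    using l m by (intro Chernoff_ineq_nn_integral_le) auto
  also have "\<dots> = ennreal (exp (l * a)) * (\<integral>\<^sup>+\<omega>. ennreal (exp (- l * s6v_height_nat \<omega> x T)) \<partial>s6v_measure b1 b2)"
    by (intro arg_cong2[where f = "(*)"] nn_integral_cong) auto
  also have "\<dots> \<le> ennreal (exp (l * a)) * ennreal (A ^ T / B ^ x)"
    unfolding A_def B_def using b d(1-4) l(1) by (intro mult_left_mono height_laplace_le bal) auto
  also have "\<dots> = ennreal (exp (l * a + (real T * ln A - real x * ln B)))"
    using AB by (simp add: ennreal_mult[symmetric] exp_add exp_diff exp_of_nat_mult)
  also have "\<dots> \<le> ennreal (exp (1 / 2 + 2 * \<kappa>) * exp (- s))"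
    using expo by (simp add: exp_add[symmetric])
  finally show ?thesis
    by (simp add: emeasure_eq_measure a_def s6v_height_def x_def)
qed

theorem proposition1p8:
  fixes b1 b2 \<kappa> :: real
  assumes "0 < b1" and "b1 < b2" and "b2 < 1"
    and "\<kappa> = s6v_kappa b1 b2"
  shows "\<exists>c :: real \<Rightarrow> real.
      (\<forall>\<epsilon>>0. c \<epsilon> > 0) \<and>
      (\<forall>\<epsilon>>0. \<forall>\<mu>\<in>{inverse \<kappa> + \<epsilon>..\<kappa> - \<epsilon>}. \<forall>T::nat. \<forall>s::real. T \<ge> 1 \<longrightarrow> s \<ge> 0 \<longrightarrow>
         \<P>(\<omega> in s6v_measure b1 b2.
              real_of_int (s6v_height \<omega> (real T * \<mu>) (real T))
                \<le> s6v_limit_shape \<kappa> \<mu> * real T - s * real T powr (1 / 3))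
           \<le> inverse (c \<epsilon>) * exp (- c \<epsilon> * s)) \<and>
      mono_on {0<..} c"
\<comment> \<open>The inverse of this constant is the prefactor in \<open>height_tail_le\<close>.
  Being at most 1, the constant may also replace the rate 1 there, as
  \<open>s \<ge> 0\<close>.\<close>
proof (intro exI[of _ "\<lambda>_. exp (- (1 / 2 + 2 * \<kappa>))"] conjI allI ballI impI)
  fix \<epsilon> \<mu> s :: real and T :: nat
  let ?C = "1 / 2 + 2 * \<kappa>"
  assume *: "0 < \<epsilon>" "\<mu> \<in> {inverse \<kappa> + \<epsilon>..\<kappa> - \<epsilon>}" "T \<ge> 1" "s \<ge> 0"
  then have "\<P>(\<omega> in s6v_measure b1 b2. real_of_int (s6v_height \<omega> (real T * \<mu>) (real T))
        \<le> s6v_limit_shape \<kappa> \<mu> * real T - s * real T powr (1 / 3)) \<le> exp ?C * exp (- s)"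
    by (intro height_tail_le[OF assms]) auto
  also have "exp ?C * exp (- s) \<le> inverse (exp (- ?C)) * exp (- exp (- ?C) * s)"
  proof -
    have "1 < \<kappa>" using assms by (simp add: s6v_kappa_def)
    then have "exp (- ?C) * s \<le> 1 * s"
      using * by (intro mult_right_mono) auto
    moreover have "inverse (exp (- ?C)) = exp ?C"
      by (simp only: exp_minus inverse_inverse_eq)
    ultimately show ?thesis by simp
  qed
  finally show "\<P>(\<omega> in s6v_measure b1 b2. real_of_int (s6v_height \<omega> (real T * \<mu>) (real T))
        \<le> s6v_limit_shape \<kappa> \<mu> * real T - s * real T powr (1 / 3))
      \<le> inverse (exp (- ?C)) * exp (- exp (- ?C) * s)" .
qed (auto simp: mono_on_def)

end
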